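(* Let $m\ge 1$ and $n\ge 2$ be integers, let $M=\{1,\dots,m\}$ be a set of items and $N=\{1,\dots,n\}$ a set of agents with linear valuations given by numbers $v_{\ell i}\ge 0$ ($\ell\in M$, $i\in N$). Let $V=\sum_{\ell\in M,\,i\in N}v_{\ell i}$ and let $B$ be a real constant with $B\ge 2V+1$. For $y=(y_{\ell i})\in\mathbb{R}^{mn}$ with rows $y_\ell=(y_{\ell 1},\dots,y_{\ell n})\in\mathbb{R}^n$, let $$h(y_\ell)=\max_{r\in N}y_{\ell r}\quad(\ell\in M),\qquad A_{kj}(y)=\max_{i\in N,\ i\neq j}\ \sum_{\ell\in M,\ \ell\neq k}\big(h(y_\ell+v_{\ell i}e_{ij})-h(y_\ell)\big)\quad(k\in M,\ j\in N),$$ where $e_{ij}=e_j-e_i$ and $e_1,\dots,e_n$ is the standard basis of $\mathbb{R}^n$. Define $\tilde T$ on $[-B,0]^{mn}$ coordinatewise by $$\tilde T_{kj}(y)=\min\big\{\,y_{kj}-h(y_k),\ -A_{kj}(y)\,e^{h(y_k)}\,\big\}\qquad (k\in M,\ j\in N).$$ Then $\tilde T$ is a continuous map from $[-B,0]^{mn}$ into itself, and it admits a fixed point. Moreover, every $y\in[-B,0]^{mn}$ which satisfies $y_{kj}-h(y_k)+A_{kj}(y)\le 0$ for all $k\in M$, $j\in N$ and $h(y_k)=0$ for all $k\in M$ (a maximal feasible solution) is a fixed point of $\tilde T$.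
   Context: Linear valuations: agent $i$ values a set $S\subseteq M$ of items at $v_i(S)=\sum_{k\in S}v_{ki}$, where $v_{ki}\ge 0$ is the value agent $i$ assigns to item $k$. *)

theory Defs
  imports "HOL-Analysis.Analysis"
begin

text \<open>
  The items are the elements of a finite type \<open>'m\<close> (nonempty, so \<open>m \<ge> 1\<close>) and the agents those of a
  finite type \<open>'n\<close>. The number \<open>v l i\<close> is the value of item \<open>l\<close> for agent \<open>i\<close>, and a point of
  \<open>\<real>\<^bsup>mn\<^esup>\<close> is a \<open>y :: real^'n^'m\<close>, with rows \<open>y $ l\<close>.
\<close>

definition h :: "real^'n::finite \<Rightarrow> real" where
  "h x = (MAX r. x $ r)"

definition e :: "'n::finite \<Rightarrow> 'n \<Rightarrow> real^'n" where
  "e i j = axis j 1 - axis i 1"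

text \<open>The maximum is over a nonempty set only if there are at least two agents.\<close>

definition A :: "('m::finite \<Rightarrow> 'n::finite \<Rightarrow> real) \<Rightarrow> real^'n^'m \<Rightarrow> 'm \<Rightarrow> 'n \<Rightarrow> real" where
  "A v y k j = (MAX i\<in>UNIV - {j}. \<Sum>l\<in>UNIV - {k}. (h (y $ l + v l i *\<^sub>R e i j) - h (y $ l)))"

definition T :: "('m::finite \<Rightarrow> 'n::finite \<Rightarrow> real) \<Rightarrow> real^'n^'m \<Rightarrow> real^'n^'m" where
  "T v y = (\<chi> k j. min (y $ k $ j - h (y $ k)) (- A v y k j * exp (h (y $ k))))"

definition cube :: "real \<Rightarrow> (real^'n::finite^'m::finite) set" where
  "cube B = {y. \<forall>k j. y $ k $ j \<in> {-B..0}}"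

definition maximal_feasible :: "('m::finite \<Rightarrow> 'n::finite \<Rightarrow> real) \<Rightarrow> real^'n^'m \<Rightarrow> bool" where
  "maximal_feasible v y \<longleftrightarrow>
     (\<forall>k j. y $ k $ j - h (y $ k) + A v y k j \<le> 0) \<and> (\<forall>k. h (y $ k) = 0)"

end

theory Submission
  imports Defs
begin

text \<open>The fixed point comes from Brouwer's theorem on the compact convex cube. Continuity
  holds because \<open>h\<close>, \<open>A\<close> and \<open>T\<close> are built from finite
  maxima, minima, sums and \<open>exp\<close>. For invariance, the first entry of the minimum is at
  most 0 and, since \<open>h\<close> is at most 0 on the cube, at least -B. The second is at least
  -B once \<open>A\<close> is at most B, and \<open>A_le_total_value\<close> bounds \<open>A\<close>
  by the total value V. At a maximal feasible point, \<open>h\<close> vanishes and feasibility makes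
  the first entry the smaller one.\<close>

lemma continuous_on_MAX:
  fixes f :: "'i \<Rightarrow> 'a::topological_space \<Rightarrow> 'b::linorder_topology"
  assumes "finite I" "I \<noteq> {}" "\<And>i. i \<in> I \<Longrightarrow> continuous_on S (f i)"
  shows "continuous_on S (\<lambda>x. MAX i\<in>I. f i x)"
  using assms
proof (induction I rule: finite_ne_induct)
  case (singleton i)
  then show ?case by simp
next
  case (insert i I)
  then have "continuous_on S (\<lambda>x. max (f i x) (MAX j\<in>I. f j x))"
    by (intro continuous_on_max) auto
  with insert.hyps show ?case by (simp add: Max_insert)
qed

lemma component_le_h: "x $ r \<le> h x"
  by (simp add: h_def)

lemma h_le_iff: "h x \<le> c \<longleftrightarrow> (\<forall>r. x $ r \<le> c)"
  by (simp add: h_def)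

lemma continuous_on_h [continuous_intros]:
  "continuous_on S f \<Longrightarrow> continuous_on S (\<lambda>x. h (f x))"
  unfolding h_def by (intro continuous_on_MAX continuous_intros) auto

text \<open>The transfer raises at most coordinate j, by c, and lowers coordinate i; for i = j it
  changes nothing.\<close>

lemma h_add_transfer_le:
  assumes "c \<ge> 0"
  shows "h (x + c *\<^sub>R e i j) \<le> h x + c"
proof -
  have "(x + c *\<^sub>R e i j) $ r \<le> h x + c" for r
    using component_le_h[of x r] assms by (auto simp: e_def axis_def)
  then show ?thesis by (simp add: h_le_iff)
qed

text \<open>Guards the maximum in \<open>A\<close>: both its continuity and its upper bound need a
  nonempty index set.\<close>

lemma agents_minus_nonempty:
  assumes "CARD('n::finite) \<ge> 2"
  shows "UNIV - {j::'n} \<noteq> {}"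
proof
  assume "UNIV - {j} = {}"
  then have "(UNIV::'n set) = {j}" by auto
  then have "CARD('n) = card {j}" by (rule arg_cong)
  with assms show False by simp
qed

text \<open>Each item l contributes at most \<open>v l i\<close>, so the sum for agent i is at most
  that agent's value for all items, hence at most V.\<close>

lemma A_le_total_value:
  fixes v :: "'m::finite \<Rightarrow> 'n::finite \<Rightarrow> real"
  assumes "CARD('n) \<ge> 2" and v: "\<And>l i. v l i \<ge> 0"
  shows "A v y k j \<le> (\<Sum>l\<in>UNIV. \<Sum>i\<in>UNIV. v l i)"
proof -
  have "(\<Sum>l\<in>UNIV - {k}. h (y $ l + v l i *\<^sub>R e i j) - h (y $ l))
      \<le> (\<Sum>l\<in>UNIV. \<Sum>i\<in>UNIV. v l i)" for i
  proof -
    have "(\<Sum>l\<in>UNIV - {k}. h (y $ l + v l i *\<^sub>R e i j) - h (y $ l)) \<le> (\<Sum>l\<in>UNIV - {k}. v l i)"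
    proof (rule sum_mono)
      show "h (y $ l + v l i *\<^sub>R e i j) - h (y $ l) \<le> v l i" for l
        using h_add_transfer_le[OF v, of "y $ l" l i i j] by linarith
    qed
    also have "\<dots> \<le> (\<Sum>l\<in>UNIV. v l i)"
      using v by (intro sum_mono2) auto
    also have "\<dots> \<le> (\<Sum>l\<in>UNIV. \<Sum>i\<in>UNIV. v l i)"
      using v by (intro sum_mono member_le_sum) auto
    finally show ?thesis .
  qed
  then show ?thesis
    unfolding A_def using agents_minus_nonempty[OF assms(1)] by (subst Max_le_iff) auto
qed

lemma continuous_on_A:
  fixes v :: "'m::finite \<Rightarrow> 'n::finite \<Rightarrow> real"
  assumes "CARD('n) \<ge> 2"
  shows "continuous_on S (\<lambda>y. A v y k j)"
  unfolding A_def using agents_minus_nonempty[OF assms]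
  by (intro continuous_on_MAX continuous_intros) auto

lemma continuous_on_T:
  fixes v :: "'m::finite \<Rightarrow> 'n::finite \<Rightarrow> real"
  assumes "CARD('n) \<ge> 2"
  shows "continuous_on S (T v)"
  unfolding T_def
  by (intro continuous_on_vec_lambda continuous_on_min continuous_intros continuous_on_A[OF assms])

lemma T_maps_cube:
  fixes v :: "'m::finite \<Rightarrow> 'n::finite \<Rightarrow> real"
  assumes "\<And>k j. A v y k j \<le> B" "B \<ge> 0" "y \<in> cube B"
  shows "T v y \<in> cube B"
proof -
  have bounds: "- B \<le> y $ k $ j" "y $ k $ j \<le> 0" for k j
    using assms(3) by (auto simp: cube_def)
  have h_nonpos: "h (y $ k) \<le> 0" for k
    using bounds by (simp add: h_le_iff)
  have "A v y k j * exp (h (y $ k)) \<le> B" for k j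
  proof -
    \<comment> \<open>The factor is positive, so this holds even where \<open>A\<close> is negative;
      it is at most 1 because \<open>h\<close> is at most 0.\<close>
    have "A v y k j * exp (h (y $ k)) \<le> B * exp (h (y $ k))"
      using assms(1) by (intro mult_right_mono) auto
    also have "\<dots> \<le> B"
      using h_nonpos assms(2) by (simp add: mult_left_le)
    finally show ?thesis .
  qed
  moreover have "- B \<le> y $ k $ j - h (y $ k)" for k j
    using bounds(1)[of k j] h_nonpos[of k] by linarith
  ultimately show ?thesis
    using component_le_h by (auto simp: cube_def T_def min_le_iff_disj minus_le_iff)
qed

text \<open>Supplies the compactness and convexity required by \<open>brouwer\<close>.\<close>

lemma cube_eq_cbox: "cube B = cbox (\<chi> k j. - B) 0"
  by (auto simp: cube_def mem_box Basis_vec_def inner_axis)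

lemma maximal_feasible_fixed_point:
  assumes "maximal_feasible v y"
  shows "T v y = y"
proof -
  have h0: "h (y $ k) = 0" for k
    using assms by (simp add: maximal_feasible_def)
  have "y $ k $ j - h (y $ k) + A v y k j \<le> 0" for k j
    using assms unfolding maximal_feasible_def by blast
  then have "y $ k $ j \<le> - A v y k j" for k j
    by (smt (verit) h0)
  \<comment> \<open>With \<open>h\<close> equal to 0 the exponential is 1, so the minimum of y and
    -A is y.\<close>
  with h0 show ?thesis
    by (simp add: T_def vec_eq_iff min_def)
qed

theorem mainTheorem6:
  fixes v :: "'m::finite \<Rightarrow> 'n::finite \<Rightarrow> real" and B :: real
  assumes "CARD('n) \<ge> 2"
    and "\<And>l i. v l i \<ge> 0"
    and "B \<ge> 2 * (\<Sum>l\<in>UNIV. \<Sum>i\<in>UNIV. v l i) + 1"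
  shows "continuous_on (cube B) (T v)
    \<and> T v ` cube B \<subseteq> cube B
    \<and> (\<exists>y\<in>cube B. T v y = y)
    \<and> (\<forall>y\<in>cube B. maximal_feasible v y \<longrightarrow> T v y = y)"
proof -
  have "(\<Sum>l\<in>UNIV. \<Sum>i\<in>UNIV. v l i) \<ge> 0"
    using assms(2) by (intro sum_nonneg) auto
  then have B: "(\<Sum>l\<in>UNIV. \<Sum>i\<in>UNIV. v l i) \<le> B" "B \<ge> 0"
    using assms(3) by linarith+
  have maps: "T v ` cube B \<subseteq> cube B"
    using T_maps_cube order_trans[OF A_le_total_value[OF assms(1,2)] B(1)] B(2) by blast
  have cont: "continuous_on (cube B) (T v)"
    by (rule continuous_on_T[OF assms(1)])
  \<comment> \<open>Nonemptiness of the cube, the remaining condition on the domain in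
    \<open>brouwer\<close>.\<close>
  have "0 \<in> (cube B :: (real^'n^'m) set)"
    using B(2) by (simp add: cube_def)
  then obtain y where "y \<in> cube B" "T v y = y"
    using brouwer[of "cube B" "T v"] cont maps
    by (auto simp: cube_eq_cbox image_subset_iff_funcset)
  with cont maps maximal_feasible_fixed_point show ?thesis by blast
qed

end
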